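(* Let $k\ge1$ be an integer and let $S=s_1,s_2,\dots$ be an infinite sequence. Then $S$ is $k$-special if and only if the edge-coloring of the infinite $k$-ary tree $T_k$ derived from $S$ is nonrepetitive.
   Context: $T_k$ is the infinite rooted tree in which every vertex has exactly $k$ children, the children of each vertex being ordered left to right. The edge-coloring derived from $S$ is defined as follows: the edges from the root to its children, from left to right, receive indices $1,2,\dots,k$; if $v$ is a non-root vertex and the edge from $v$ to its parent has index $i$, then the edges from $v$ to its children, from left to right, receive indices $i+1,\dots,i+k$; an edge with index $i$ receives color $s_i$. A repetition is a finite sequence $x_1,\dots,x_{2r}$ ($r\ge1$) with $x_j=x_{j+r}$ for $1\le j\le r$. An edge-coloring is nonrepetitive if the sequence of colors along no path with at least one edge is a repetition. A sequence of indices $i_1,\dots,i_{2r}$ ($r\ge 1$) is $k$-bad for $S$ if there is $m$ with $1<m\le 2r$ such that: (a) $s_{i_j}=s_{i_{j+r}}$ for $1\le j\le r$; (b) $i_1>i_2>\dots>i_m<i_{m+1}<\dots<i_{2r}$; (c) $|i_j-i_{j+1}|\le k$ for $1\le j<2r$; (d) $i_{m+1}<i_m+k$ if $m<2r$. $S$ is $k$-special if it has no $k$-bad sequence of indices. *)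

theory Defs
  imports Main
begin

definition repetition :: "'c list \<Rightarrow> bool" where
  "repetition xs \<longleftrightarrow> (\<exists>r\<ge>1. length xs = 2 * r \<and> (\<forall>j<r. xs ! j = xs ! (j + r)))"

definition graph_path :: "'v set \<Rightarrow> 'v set set \<Rightarrow> 'v list \<Rightarrow> bool" where
  "graph_path V E p \<longleftrightarrow>
     p \<noteq> [] \<and> set p \<subseteq> V \<and> distinct p \<and> successively (\<lambda>u v. {u, v} \<in> E) p"

definition path_edges :: "'v list \<Rightarrow> 'v set list" where
  "path_edges p = map2 (\<lambda>u v. {u, v}) (butlast p) (tl p)"

definition nonrepetitive :: "'v set \<Rightarrow> 'v set set \<Rightarrow> ('v set \<Rightarrow> 'c) \<Rightarrow> bool" where
  "nonrepetitive V E c \<longleftrightarrow>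
     (\<forall>p. graph_path V E p \<and> path_edges p \<noteq> [] \<longrightarrow> \<not> repetition (map c (path_edges p)))"

text \<open>
  A vertex is the list of child positions on its path to the root, read from the vertex
  upwards: the root is \<open>[]\<close>, and the \<open>j\<close>-th child of \<open>v\<close> from the left is \<open>j # v\<close>,
  with \<open>1 \<le> j \<le> k\<close>.
\<close>

definition tree_verts :: "nat \<Rightarrow> nat list set" where
  "tree_verts k = lists {1..k}"

definition tree_edges :: "nat \<Rightarrow> nat list set set" where
  "tree_edges k = {{v, j # v} | v j. v \<in> tree_verts k \<and> j \<in> {1..k}}"

text \<open>The index of the edge from a non-root vertex to its parent; the value at the root is
  irrelevant.\<close>

fun parent_edge_index :: "nat list \<Rightarrow> nat" where
  "parent_edge_index [] = 0"
| "parent_edge_index [j] = j"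
| "parent_edge_index (j # i # v) = parent_edge_index (i # v) + j"

definition edge_index :: "nat list set \<Rightarrow> nat" where
  "edge_index e = (THE n. \<exists>v j. e = {v, j # v} \<and> n = parent_edge_index (j # v))"

lemma edge_index_eq: "edge_index {v, j # v} = parent_edge_index (j # v)"
  unfolding edge_index_def by (rule the_equality) (auto simp: doubleton_eq_iff)

text \<open>A sequence \<open>s\<^sub>1, s\<^sub>2, \<dots>\<close> is a function on \<^typ>\<open>nat\<close> whose value at \<open>0\<close> is never used.\<close>

definition derived_coloring :: "(nat \<Rightarrow> 'a) \<Rightarrow> nat list set \<Rightarrow> 'a" where
  "derived_coloring S e = S (edge_index e)"

text \<open>The sequence \<open>i\<^sub>1, \<dots>, i\<^bsub>2r\<^esub>\<close> is given by \<open>r\<close> and the values of \<open>i\<close> on \<open>{1..2 * r}\<close>;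
  all indices are positive.\<close>

definition bad_indices :: "nat \<Rightarrow> (nat \<Rightarrow> 'a) \<Rightarrow> nat \<Rightarrow> (nat \<Rightarrow> nat) \<Rightarrow> bool" where
  "bad_indices k S r i \<longleftrightarrow>
     1 \<le> r \<and> (\<forall>j\<in>{1..2*r}. 1 \<le> i j) \<and>
     (\<exists>m. 1 < m \<and> m \<le> 2 * r \<and>
        (\<forall>j\<in>{1..r}. S (i j) = S (i (j + r))) \<and>
        (\<forall>j\<in>{1..<m}. i j > i (j + 1)) \<and> (\<forall>j\<in>{m..<2*r}. i j < i (j + 1)) \<and>
        (\<forall>j\<in>{1..<2*r}. \<bar>int (i j) - int (i (j + 1))\<bar> \<le> int k) \<and>
        (m < 2 * r \<longrightarrow> i (m + 1) < i m + k))"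

definition special :: "nat \<Rightarrow> (nat \<Rightarrow> 'a) \<Rightarrow> bool" where
  "special k S \<longleftrightarrow> (\<nexists>r i. bad_indices k S r i)"

end

theory Submission
  imports Defs
begin

text \<open>
  A path in the tree climbs to its topmost vertex and then descends, so its index sequence is
  first decreasing and then increasing, with steps of size at most \<open>k\<close>; the two indices around
  the topmost vertex belong to distinct children of it, hence are different and differ by less
  than \<open>k\<close>. Up to reversing the path, these are the sequences in the definition of badness.
  Conversely, given such a sequence with minimum \<open>i\<^sub>m\<close>, take any vertex whose child
  positions sum to \<open>i\<^sub>m - 1\<close> as the topmost vertex, enter it from its first child, and read all
  other child positions off the differences of consecutive indices.
\<close>

section \<open>Paths with evenly many edges as vertex functions\<close>

lemma length_path_edges: "length (path_edges p) = length p - 1"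
  by (simp add: path_edges_def)

lemma path_edges_nth:
  "Suc n < length p \<Longrightarrow> path_edges p ! n = {p ! n, p ! Suc n}"
  by (simp add: path_edges_def nth_butlast nth_tl)

text \<open>A path with 2r edges is enumerated by its 2r + 1 distinct vertices \<open>P 0\<close>,
  ..., \<open>P (2*r)\<close>. This trades lists for functions, so that later steps need only
  arithmetic on positions.\<close>

lemma nonrepetitive_iff:
  "nonrepetitive V E c \<longleftrightarrow>
     (\<nexists>r P. 1 \<le> r \<and> inj_on P {..2*r} \<and> P ` {..2*r} \<subseteq> V \<and>
        (\<forall>n<2*r. {P n, P (Suc n)} \<in> E) \<and>
        (\<forall>n<r. c {P n, P (Suc n)} = c {P (n + r), P (Suc (n + r))}))"
    (is "_ \<longleftrightarrow> (\<nexists>r P. ?Q r P)")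
proof
  assume nr: "nonrepetitive V E c"
  show "\<nexists>r P. ?Q r P"
  proof
    assume "\<exists>r P. ?Q r P"
    then obtain r P where Q: "?Q r P"
      by blast
    define p where "p = map P [0..<Suc (2*r)]"
    have len: "length p = Suc (2*r)"
      by (simp add: p_def)
    have nth: "p ! n = P n" if "n \<le> 2*r" for n
      using that unfolding p_def by (subst nth_map) (auto simp del: upt_Suc)
    have set: "{0..<Suc (2*r)} = {..2*r}"
      by auto
    have "graph_path V E p"
      unfolding graph_path_def
    proof (intro conjI)
      show "p \<noteq> []"
        using len by auto
      show "set p \<subseteq> V" "distinct p"
        using Q by (auto simp add: p_def distinct_map set simp del: upt_Suc)
      show "successively (\<lambda>u v. {u, v} \<in> E) p"
        using Q len nth by (auto simp: successively_conv_nth)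
    qed
    moreover have "path_edges p \<noteq> []"
      using Q len length_path_edges[of p] by auto
    moreover have "repetition (map c (path_edges p))"
      unfolding repetition_def
    proof (intro exI[of _ r] conjI allI impI)
      fix j assume "j < r"
      with Q show "map c (path_edges p) ! j = map c (path_edges p) ! (j + r)"
        by (simp add: length_path_edges path_edges_nth len nth)
    qed (use Q len in \<open>auto simp: length_path_edges\<close>)
    ultimately show False
      using nr unfolding nonrepetitive_def by blast
  qed
next
  assume nex: "\<nexists>r P. ?Q r P"
  show "nonrepetitive V E c"
    unfolding nonrepetitive_def
  proof (intro allI impI notI)
    fix p
    assume "graph_path V E p \<and> path_edges p \<noteq> []" and "repetition (map c (path_edges p))"
    then obtain r where r: "1 \<le> r" "length p - 1 = 2*r"
      and rep: "\<And>j. j < r \<Longrightarrow>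
        map c (path_edges p) ! j = map c (path_edges p) ! (j + r)"
      and path: "p \<noteq> []" "set p \<subseteq> V" "distinct p" "successively (\<lambda>u v. {u, v} \<in> E) p"
      by (auto simp: repetition_def length_path_edges graph_path_def)
    have len: "length p = Suc (2*r)"
      using r by simp
    have "?Q r ((!) p)"
    proof (intro conjI allI impI)
      show "inj_on ((!) p) {..2*r}"
        using path(3) len by (auto simp: inj_on_def nth_eq_iff_index_eq)
      show "(!) p ` {..2*r} \<subseteq> V"
        using path(2) len by (auto simp: subset_iff)
      show "{p ! n, p ! Suc n} \<in> E" if "n < 2*r" for n
        using path(4) len that by (auto simp: successively_conv_nth)
      show "c {p ! n, p ! Suc n} = c {p ! (n + r), p ! Suc (n + r)}" if "n < r" for n
        using rep[OF that] that by (simp add: length_path_edges path_edges_nth len)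
    qed (use r in auto)
    with nex show False
      by blast
  qed
qed

section \<open>Edge indices as sums of child positions\<close>

text \<open>Each step downwards adds its child position to the index. Hence child positions can be
  recovered as differences of consecutive indices.\<close>

lemma parent_edge_index_eq: "parent_edge_index v = sum_list v"
  by (induction v rule: parent_edge_index.induct) auto

lemma edge_index_down: "edge_index {v, x # v} = x + sum_list v"
  and edge_index_up: "edge_index {x # v, v} = x + sum_list v"
  by (simp_all only: edge_index_eq parent_edge_index_eq sum_list.Cons insert_commute[of "x # v"])

section \<open>Valleys, their reversal and bad sequences\<close>

text \<open>
  The index sequences of tree paths with \<open>a\<close> upward and \<open>2 * r - a\<close> downward edges. Unlike
  badness, this notion is symmetric under reversal.
\<close>

definition valley :: "nat \<Rightarrow> (nat \<Rightarrow> 'a) \<Rightarrow> nat \<Rightarrow> (nat \<Rightarrow> nat) \<Rightarrow> nat \<Rightarrow> bool" where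
  "valley k S r i a \<longleftrightarrow>
     1 \<le> r \<and> a \<le> 2 * r \<and> (\<forall>j\<in>{1..2*r}. 1 \<le> i j) \<and>
     (\<forall>j\<in>{1..r}. S (i j) = S (i (j + r))) \<and>
     (\<forall>j\<in>{1..<a}. i (j + 1) < i j \<and> i j \<le> i (j + 1) + k) \<and>
     (\<forall>j\<in>{a<..<2*r}. i j < i (j + 1) \<and> i (j + 1) \<le> i j + k) \<and>
     (0 < a \<and> a < 2 * r \<longrightarrow> i a \<noteq> i (a + 1) \<and> i a < i (a + 1) + k \<and> i (a + 1) < i a + k)"

text \<open>Reading a path backwards exchanges climbing and descending edges, and the turn
  \<open>a\<close>, \<open>a + 1\<close> goes to itself with its two ends swapped.\<close>

lemma valley_reverse:
  assumes v: "valley k S r i a"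
  shows "valley k S r (\<lambda>j. i (2 * r + 1 - j)) (2 * r - a)"
  unfolding valley_def
proof (intro conjI ballI impI)
  fix j assume "j \<in> {1..2 * r}"
  then have "2 * r + 1 - j \<in> {1..2 * r}"
    by auto
  with v show "1 \<le> i (2 * r + 1 - j)"
    unfolding valley_def by blast
next
  fix j assume j: "j \<in> {1..r}"
  \<comment> \<open>The positions \<open>j\<close> and \<open>j + r\<close> are mirrored to
    \<open>r + 1 - j + r\<close> and \<open>r + 1 - j\<close>, which again lie \<open>r\<close>
    apart.\<close>
  have "S (i (r + 1 - j)) = S (i (r + 1 - j + r))"
    using v j unfolding valley_def by (elim conjE ballE[of "{1..r}" _ "r + 1 - j"]) auto
  moreover have "r + 1 - j + r = 2 * r + 1 - j" "r + 1 - j = 2 * r + 1 - (j + r)"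
    using j by auto
  ultimately show "S (i (2 * r + 1 - j)) = S (i (2 * r + 1 - (j + r)))"
    by simp
next
  fix j assume j: "j \<in> {1..<2 * r - a}"
  have "2 * r - j \<in> {a<..<2*r}" "2 * r + 1 - j = 2 * r - j + 1" "2 * r + 1 - (j + 1) = 2 * r - j"
    using j by auto
  with v show "i (2 * r + 1 - (j + 1)) < i (2 * r + 1 - j)"
    "i (2 * r + 1 - j) \<le> i (2 * r + 1 - (j + 1)) + k"
    unfolding valley_def by metis+
next
  fix j assume j: "j \<in> {2 * r - a<..<2 * r}"
  have "2 * r - j \<in> {1..<a}" "2 * r + 1 - j = 2 * r - j + 1" "2 * r + 1 - (j + 1) = 2 * r - j"
    using j by auto
  with v show "i (2 * r + 1 - j) < i (2 * r + 1 - (j + 1))"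
    "i (2 * r + 1 - (j + 1)) \<le> i (2 * r + 1 - j) + k"
    unfolding valley_def by metis+
next
  assume a: "0 < 2 * r - a \<and> 2 * r - a < 2 * r"
  have "2 * r + 1 - (2 * r - a) = a + 1" "2 * r + 1 - (2 * r - a + 1) = a" "0 < a \<and> a < 2 * r"
    using a by auto
  with v show "i (2 * r + 1 - (2 * r - a)) \<noteq> i (2 * r + 1 - (2 * r - a + 1))"
    "i (2 * r + 1 - (2 * r - a)) < i (2 * r + 1 - (2 * r - a + 1)) + k"
    "i (2 * r + 1 - (2 * r - a + 1)) < i (2 * r + 1 - (2 * r - a)) + k"
    unfolding valley_def by metis+
qed (use v in \<open>auto simp: valley_def\<close>)

text \<open>The witness is \<open>m = 2 * r\<close>, for which the increasing part and condition (d)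
  are vacuous. The valley gives the steps before \<open>a\<close>, and \<open>dec\<close> those from
  \<open>a\<close> on.\<close>

lemma bad_indices_decreasing:
  assumes v: "valley k S r i a"
    and dec: "\<And>j. a \<le> j \<Longrightarrow> 1 \<le> j \<Longrightarrow> j < 2 * r \<Longrightarrow> i (j + 1) < i j \<and> i j \<le> i (j + 1) + k"
  shows "bad_indices k S r i"
proof -
  have dec': "i (j + 1) < i j \<and> i j \<le> i (j + 1) + k" if "j \<in> {1..<2*r}" for j
    using v dec[of j] that by (cases "j < a") (auto simp: valley_def)
  show ?thesis
    unfolding bad_indices_def
  proof (intro conjI exI[of _ "2 * r"] ballI)
    fix j assume "j \<in> {1..<2*r}"
    from dec'[OF this] show "\<bar>int (i j) - int (i (j + 1))\<bar> \<le> int k"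
      by linarith
  qed (use v dec' in \<open>auto simp: valley_def\<close>)
qed

text \<open>The witness is \<open>m = a\<close>: \<open>less\<close> lets the increasing part start
  at \<open>a\<close>, and the strict bound at the turn is condition (d).\<close>

lemma bad_indices_valley:
  assumes v: "valley k S r i a" and a: "1 < a" "a < 2 * r" and less: "i a < i (a + 1)"
  shows "bad_indices k S r i"
  unfolding bad_indices_def
proof (intro conjI exI[of _ a] ballI)
  fix j assume j: "j \<in> {1..<2*r}"
  consider "j < a" | "j = a" | "a < j"
    by linarith
  then show "\<bar>int (i j) - int (i (j + 1))\<bar> \<le> int k"
  proof cases
    case 1
    then have "i (j + 1) < i j \<and> i j \<le> i (j + 1) + k"
      using v j by (auto simp: valley_def)
    then show ?thesis by linarith
  next
    case 2
    then have "i j < i (j + 1) + k \<and> i (j + 1) < i j + k"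
      using v a by (auto simp: valley_def)
    then show ?thesis by linarith
  next
    case 3
    then have "i j < i (j + 1) \<and> i (j + 1) \<le> i j + k"
      using v j by (auto simp: valley_def)
    then show ?thesis by linarith
  qed
next
  fix j assume "j \<in> {a..<2*r}"
  then show "i j < i (j + 1)"
    using v less by (cases "j = a") (auto simp: valley_def)
qed (use v a in \<open>auto simp: valley_def\<close>)

text \<open>
  Of the two indices at the turn, the larger one must come second for condition (d) to hold;
  otherwise the sequence is reversed. If only one edge lies on the side of the smaller index,
  the sequence is monotone.
\<close>

lemma valley_not_special:
  assumes v: "valley k S r i a"
  shows "\<not> special k S"
proof -
  let ?i' = "\<lambda>j. i (2 * r + 1 - j)"
  have turn: "\<not> special k S"
    if v: "valley k S r i a" and a: "0 < a" "a < 2 * r" and less: "i a < i (a + 1)" for i a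
  proof (cases "a = 1")
    \<comment> \<open>The choice \<open>m = a\<close> would violate \<open>1 < m\<close>. The
      sequence increases throughout, so its reversal decreases.\<close>
    case True
    have "bad_indices k S r (\<lambda>j. i (2 * r + 1 - j))"
    proof (rule bad_indices_decreasing[OF valley_reverse[OF v]])
      fix j assume "2 * r - a \<le> j" "1 \<le> j" "j < 2 * r"
      with True have "2 * r + 1 - j = a + 1" "2 * r + 1 - (j + 1) = a"
        by auto
      with v a less show "i (2 * r + 1 - (j + 1)) < i (2 * r + 1 - j) \<and>
          i (2 * r + 1 - j) \<le> i (2 * r + 1 - (j + 1)) + k"
        by (auto simp: valley_def)
    qed
    then show ?thesis
      unfolding special_def by blast
  next
    case False
    with bad_indices_valley[OF v] a less show ?thesis
      unfolding special_def by auto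
  qed
  have v': "valley k S r ?i' (2 * r - a)"
    by (rule valley_reverse[OF v])
  have "a \<le> 2 * r"
    using v by (simp add: valley_def)
  then consider "a = 2 * r" | "a = 0" | "0 < a" "a < 2 * r" "i a < i (a + 1)"
    | "0 < a" "a < 2 * r" "i (a + 1) < i a"
    using v unfolding valley_def by (metis bot_nat_0.not_eq_extremum le_neq_implies_less nat_neq_iff)
  then show ?thesis
  proof cases
    \<comment> \<open>Without a turn the path only climbs, or only descends and is read backwards;
      either way \<open>dec\<close> is vacuous.\<close>
    case 1
    then show ?thesis
      using bad_indices_decreasing[OF v] unfolding special_def by auto
  next
    case 2
    then show ?thesis
      using bad_indices_decreasing[OF v'] unfolding special_def by auto
  next
    case 3
    then show ?thesis
      using turn[OF v] by blast
  next
    case 4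
    have "2 * r + 1 - (2 * r - a) = a + 1" "2 * r + 1 - (2 * r - a + 1) = a"
      using 4 by auto
    with 4 show ?thesis
      using turn[OF v'] by auto
  qed
qed

section \<open>From tree paths to valleys\<close>

text \<open>Parents are unique, so climbing right after a descent would revisit a vertex. Hence all
  climbing edges precede all descending ones.\<close>

lemma tree_path_valley:
  fixes P :: "nat \<Rightarrow> nat list"
  assumes r: "1 \<le> r" and inj: "inj_on P {..2*r}"
    and adj: "\<And>n. n < 2*r \<Longrightarrow> {P n, P (Suc n)} \<in> tree_edges k"
    and rep: "\<And>n. n < r \<Longrightarrow>
      S (edge_index {P n, P (Suc n)}) = S (edge_index {P (n + r), P (Suc (n + r))})"
  shows "\<exists>a. valley k S r (\<lambda>j. edge_index {P (j - 1), P j}) a"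
proof -
  define up where "up n \<longleftrightarrow> (\<exists>x\<in>{1..k}. P n = x # P (Suc n))" for n
  define down where "down n \<longleftrightarrow> (\<exists>x\<in>{1..k}. P (Suc n) = x # P n)" for n
  have ud: "up n \<or> down n" if "n < 2*r" for n
    using adj[OF that] unfolding tree_edges_def up_def down_def
    by (auto simp: doubleton_eq_iff)
  have apart: "P n \<noteq> P (Suc (Suc n))" if "Suc n < 2*r" for n
    using inj_onD[OF inj, of n "Suc (Suc n)"] that by auto
  have down_Suc: "down (Suc n)" if "down n" "Suc n < 2*r" for n
    using that ud[of "Suc n"] apart[of n] by (auto simp: up_def down_def)
  \<comment> \<open>The position of the first descending edge, or \<open>2*r\<close> if there is
    none; it is also the number of climbing edges.\<close>
  define a where "a = (LEAST n. n = 2*r \<or> down n)"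
  have a: "a = 2*r \<or> down a"
    unfolding a_def by (rule LeastI[of _ "2*r"]) simp
  have a_le: "a \<le> 2*r"
    unfolding a_def by (rule Least_le) simp
  have up: "up n" if "n < a" for n
    using not_less_Least[of n "\<lambda>n. n = 2*r \<or> down n"] that a_le ud[of n]
    unfolding a_def[symmetric] by auto
  have down: "down n" if "a \<le> n" "n < 2*r" for n
    using that
  proof (induction n rule: dec_induct)
    case base
    then show ?case using a by auto
  next
    case (step n)
    then show ?case using down_Suc by auto
  qed
  let ?i = "\<lambda>j. edge_index {P (j - 1), P j}"
  have "valley k S r ?i a"
    unfolding valley_def
  proof (intro conjI ballI impI)
    fix j assume "j \<in> {1..2*r}"
    then obtain n where "j = Suc n" "n < 2*r"
      by (cases j) auto
    then show "1 \<le> ?i j"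
      using ud[of n] by (auto simp: up_def down_def edge_index_up edge_index_down)
  next
    fix j assume j: "j \<in> {1..r}"
    then obtain n where "j = Suc n" "n < r"
      by (cases j) auto
    then show "S (?i j) = S (?i (j + r))"
      using rep[of n] by simp
  next
    fix j assume j: "j \<in> {1..<a}"
    then obtain n where n: "j = Suc n" "Suc n < a"
      by (cases j) auto
    then have "up n" "up (Suc n)"
      using up by auto
    then show "?i (j + 1) < ?i j" "?i j \<le> ?i (j + 1) + k"
      using n by (auto simp: up_def edge_index_up)
  next
    fix j assume j: "j \<in> {a<..<2*r}"
    then obtain n where n: "j = Suc n" "a \<le> n" "Suc n < 2*r"
      by (cases j) auto
    then have "down n" "down (Suc n)"
      using down by auto
    then show "?i j < ?i (j + 1)" "?i (j + 1) \<le> ?i j + k"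
      using n by (auto simp: down_def edge_index_down)
  next
    assume "0 < a \<and> a < 2 * r"
    then obtain n where n: "a = Suc n" "Suc n < 2*r"
      by (cases a) auto
    then have "up n" "down (Suc n)"
      using up down by auto
    \<comment> \<open>Both edges hang from \<open>P (Suc n)\<close>; \<open>apart\<close> makes
      their child positions distinct elements of \<open>{1..k}\<close>, which therefore differ by
      less than \<open>k\<close>.\<close>
    then show "?i a \<noteq> ?i (a + 1)" "?i a < ?i (a + 1) + k" "?i (a + 1) < ?i a + k"
      using n apart[of n] by (auto simp: up_def down_def edge_index_up edge_index_down)
  qed (use r a_le in auto)
  then show ?thesis ..
qed

section \<open>From bad sequences to tree paths\<close>

text \<open>Descends from \<open>u\<close> so that the vertex at depth \<open>d\<close> below it
  gets sum \<open>h d\<close>, provided that \<open>h\<close> increases from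
  \<open>sum_list u\<close>; truncated subtraction is then harmless.\<close>

fun extend :: "nat list \<Rightarrow> (nat \<Rightarrow> nat) \<Rightarrow> nat \<Rightarrow> nat list" where
  "extend u h 0 = u"
| "extend u h (Suc d) = (h (Suc d) - h d) # extend u h d"

lemma length_extend [simp]: "length (extend u h d) = length u + d"
  by (induction d) auto

lemma sum_list_extend:
  assumes "sum_list u = h 0" "\<And>e. e < d \<Longrightarrow> h e < h (Suc e)"
  shows "sum_list (extend u h d) = h d"
  using assms(2) by (induction d) (auto simp: assms(1) less_imp_le)

lemma extend_in_lists:
  assumes "u \<in> lists {1..k}"
    and "\<And>e. e < d \<Longrightarrow> h e < h (Suc e) \<and> h (Suc e) \<le> h e + k"
  shows "extend u h d \<in> lists {1..k}"
  using assms(2) by (induction d) (use assms(1) in \<open>auto simp: Suc_le_eq le_diff_conv add.commute\<close>)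

text \<open>Stripping heads passes to ancestors, so two branches from \<open>u\<close> that meet at
  equal depth agree already in their first step.\<close>

lemma extend_eqD: "extend u g (Suc d) = extend u h (Suc d) \<Longrightarrow> extend u g 1 = extend u h 1"
  by (induction d) auto

text \<open>
  The vertex at position \<open>n\<close> of the path gets child positions summing to \<open>h n\<close>; the topmost
  vertex is the one at position \<open>m\<close>.
\<close>

lemma bad_indices_tree_path:
  assumes k: "k \<ge> 1" and bad: "bad_indices k S r i"
  obtains P where "inj_on P {..2*r}" "P ` {..2*r} \<subseteq> tree_verts k"
    "\<And>n. n < 2*r \<Longrightarrow> {P n, P (Suc n)} \<in> tree_edges k"
    "\<And>n. n < 2*r \<Longrightarrow> edge_index {P n, P (Suc n)} = i (Suc n)"
proof -
  obtain m where m: "1 < m" "m \<le> 2*r"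
    and pos: "\<And>j. 1 \<le> j \<Longrightarrow> j \<le> 2*r \<Longrightarrow> 1 \<le> i j"
    and dec: "\<And>j. 1 \<le> j \<Longrightarrow> j < m \<Longrightarrow> i (Suc j) < i j"
    and inc: "\<And>j. m \<le> j \<Longrightarrow> j < 2*r \<Longrightarrow> i j < i (Suc j)"
    and step: "\<And>j. 1 \<le> j \<Longrightarrow> j < 2*r \<Longrightarrow> i j \<le> i (Suc j) + k \<and> i (Suc j) \<le> i j + k"
    and turn: "m < 2*r \<Longrightarrow> i (Suc m) < i m + k"
  proof -
    from bad obtain m where "1 < m" "m \<le> 2*r"
      and *: "\<forall>j\<in>{1..2*r}. 1 \<le> i j" "\<forall>j\<in>{1..<m}. i j > i (j + 1)"
        "\<forall>j\<in>{m..<2*r}. i j < i (j + 1)"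
        "\<forall>j\<in>{1..<2*r}. \<bar>int (i j) - int (i (j + 1))\<bar> \<le> int k"
        "m < 2 * r \<longrightarrow> i (m + 1) < i m + k"
      unfolding bad_indices_def by blast
    moreover have "i j \<le> i (Suc j) + k \<and> i (Suc j) \<le> i j + k" if "1 \<le> j" "j < 2*r" for j
    proof -
      have "\<bar>int (i j) - int (i (j + 1))\<bar> \<le> int k"
        using *(4) that by auto
      then show ?thesis by (simp add: abs_le_iff)
    qed
    ultimately show ?thesis
      using that by auto
  qed
  \<comment> \<open>Edge \<open>Suc n\<close> joins positions \<open>n\<close> and
    \<open>Suc n\<close>, and its index is the sum at its lower end: position \<open>n\<close>
    before the top, \<open>Suc n\<close> after it. The value \<open>i m - 1\<close> makes the top be
    entered from its first child.\<close>
  define h where "h n = (if n < m then i (Suc n) else if n = m then i m - 1 else i n)" for n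
  have im: "1 \<le> i m"
    using pos m by auto
  have h_up: "h (Suc n) < h n \<and> h n \<le> h (Suc n) + k" if "n < m" for n
  proof (cases "Suc n = m")
    case True
    then show ?thesis using im k by (auto simp: h_def)
  next
    case False
    then show ?thesis
      using that dec[of "Suc n"] step[of "Suc n"] m by (auto simp: h_def)
  qed
  have h_down: "h n < h (Suc n) \<and> h (Suc n) \<le> h n + k" if "m \<le> n" "n < 2*r" for n
  \<comment> \<open>The first descent has child position \<open>i (Suc m) - i m + 1\<close>, which
    is at most \<open>k\<close> exactly by condition (d).\<close>
  proof (cases "n = m")
    case True
    then show ?thesis using im turn inc[of m] that by (auto simp: h_def)
  next
    case False
    then show ?thesis
      using that inc[of n] step[of n] m by (auto simp: h_def)
  qed
  \<comment> \<open>Following first children gives a vertex with the required sum; \<open>im\<close>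
    makes the subtraction exact.\<close>
  define u where "u = replicate (i m - 1) (1::nat)"
  have u: "u \<in> lists {1..k}" "sum_list u = h m"
    using k by (auto simp: u_def h_def sum_list_replicate)
  \<comment> \<open>Both branches are parametrised by depth below the top.\<close>
  let ?hA = "\<lambda>d. h (m - d)" and ?hB = "\<lambda>d. h (m + d)"
  define A where "A = extend u ?hA"
  define B where "B = extend u ?hB"
  define P where "P n = (if n \<le> m then A (m - n) else B (n - m))" for n
  have hA: "?hA e < ?hA (Suc e) \<and> ?hA (Suc e) \<le> ?hA e + k" if "e < m" for e
    using h_up[of "m - Suc e"] that by (simp add: Suc_diff_Suc)
  have hB: "?hB e < ?hB (Suc e) \<and> ?hB (Suc e) \<le> ?hB e + k" if "e < 2*r - m" for e
    using h_down[of "m + e"] that by simp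
  have A_in: "A d \<in> lists {1..k}" if "d \<le> m" for d
    unfolding A_def by (rule extend_in_lists[OF u(1)]) (use that hA in simp)
  have A_sum: "sum_list (A d) = h (m - d)" if "d \<le> m" for d
    unfolding A_def by (rule sum_list_extend) (use that hA u(2) in simp_all)
  have B_in: "B d \<in> lists {1..k}" if "d \<le> 2*r - m" for d
    unfolding B_def by (rule extend_in_lists[OF u(1)]) (use that hB in simp)
  have B_sum: "sum_list (B d) = h (m + d)" if "d \<le> 2*r - m" for d
    unfolding B_def by (rule sum_list_extend) (use that hB u(2) in simp_all)
  have P_in: "P n \<in> lists {1..k}" and P_sum: "sum_list (P n) = h n" if "n \<le> 2*r" for n
    using that A_in[of "m - n"] B_in[of "n - m"] A_sum[of "m - n"] B_sum[of "n - m"]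
    by (auto simp: P_def simp del: in_lists_conv_set)
  have P_up: "P n = (h n - h (Suc n)) # P (Suc n)" if "n < m" for n
  proof -
    have "m - n = Suc (m - Suc n)" using that by simp
    then show ?thesis using that by (simp add: P_def A_def)
  qed
  have P_down: "P (Suc n) = (h (Suc n) - h n) # P n" if "m \<le> n" for n
    using that by (auto simp: P_def B_def A_def Suc_diff_le)
  have A_ne_B: "A d \<noteq> B d'" if "d' > 0" "d' \<le> 2*r - m" for d d'
  proof
    assume eq: "A d = B d'"
    then have "length (A d) = length (B d')"
      by simp
    then have "d = d'"
      by (simp add: A_def B_def)
    with eq that obtain e where "A (Suc e) = B (Suc e)" "m < 2*r"
      by (cases d') auto
    then have "extend u ?hA 1 = extend u ?hB 1"
      unfolding A_def B_def using extend_eqD by blast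
    \<comment> \<open>The first step of \<open>A\<close> has child position 1, that of
      \<open>B\<close> at least 2.\<close>
    then show False
      using inc[of m] im m \<open>m < 2*r\<close> by (auto simp: h_def)
  qed
  have "inj_on P {..2*r}"
  proof (rule inj_onI)
    fix x y assume xy: "x \<in> {..2*r}" "y \<in> {..2*r}" "P x = P y"
    \<comment> \<open>Two positions of the same vertex lie on the same branch, where the length of
      the vertex determines the position.\<close>
    then have "x \<le> m \<longleftrightarrow> y \<le> m"
      using A_ne_B[of "y - m" "m - x"] A_ne_B[of "x - m" "m - y"]
      by (auto simp: P_def diff_le_mono split: if_splits)
    moreover have "length (P x) = length (P y)"
      using xy by simp
    ultimately show "x = y"
      by (auto simp: P_def A_def B_def split: if_splits)
  qed
  moreover have "P ` {..2*r} \<subseteq> tree_verts k"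
    using P_in by (auto simp: tree_verts_def simp del: in_lists_conv_set)
  moreover have "{P n, P (Suc n)} \<in> tree_edges k \<and> edge_index {P n, P (Suc n)} = i (Suc n)"
    if n: "n < 2*r" for n
  proof (cases "n < m")
    case True
    define x where "x = h n - h (Suc n)"
    have x: "x \<in> {1..k}" "P n = x # P (Suc n)"
      using h_up[OF True] P_up[OF True] by (auto simp: x_def)
    have "edge_index {P n, P (Suc n)} = x + sum_list (P (Suc n))"
      unfolding x(2) by (rule edge_index_up)
    also have "\<dots> = h n"
      using P_sum[of "Suc n"] n h_up[OF True] by (simp add: x_def)
    finally show ?thesis
      using x P_in[of "Suc n"] n True
      unfolding tree_edges_def tree_verts_def by (fastforce simp: h_def insert_commute)
  next
    case False
    define x where "x = h (Suc n) - h n"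
    have x: "x \<in> {1..k}" "P (Suc n) = x # P n"
      using h_down[of n] P_down[of n] False n by (auto simp: x_def)
    have "edge_index {P n, P (Suc n)} = x + sum_list (P n)"
      unfolding x(2) by (rule edge_index_down)
    also have "\<dots> = h (Suc n)"
      using P_sum[of n] n h_down[of n] False by (simp add: x_def)
    finally show ?thesis
      using x P_in[of n] n False
      unfolding tree_edges_def tree_verts_def by (fastforce simp: h_def)
  qed
  ultimately show ?thesis
    using that by blast
qed

theorem theorem5:
  fixes k :: nat and S :: "nat \<Rightarrow> 'a"
  assumes "k \<ge> 1"
  shows "special k S \<longleftrightarrow> nonrepetitive (tree_verts k) (tree_edges k) (derived_coloring S)"
proof
  assume special: "special k S"
  show "nonrepetitive (tree_verts k) (tree_edges k) (derived_coloring S)"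
    unfolding nonrepetitive_iff derived_coloring_def
    using tree_path_valley[where S = S] valley_not_special special by meson
next
  assume nonrep: "nonrepetitive (tree_verts k) (tree_edges k) (derived_coloring S)"
  show "special k S"
    unfolding special_def
  proof (intro notI, elim exE)
    fix r i assume bad: "bad_indices k S r i"
    obtain P where P: "inj_on P {..2*r}" "P ` {..2*r} \<subseteq> tree_verts k"
      "\<And>n. n < 2*r \<Longrightarrow> {P n, P (Suc n)} \<in> tree_edges k"
      "\<And>n. n < 2*r \<Longrightarrow> edge_index {P n, P (Suc n)} = i (Suc n)"
      using bad_indices_tree_path[OF assms bad] by metis
    have "1 \<le> r" and rep: "\<forall>j\<in>{1..r}. S (i j) = S (i (j + r))"
      using bad unfolding bad_indices_def by blast+
    moreover have "derived_coloring S {P n, P (Suc n)} =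
        derived_coloring S {P (n + r), P (Suc (n + r))}" if "n < r" for n
      using rep[rule_format, of "Suc n"] that P(4)[of n] P(4)[of "n + r"]
      by (simp add: derived_coloring_def)
    ultimately show False
      using nonrep P(1-3) unfolding nonrepetitive_iff by blast
  qed
qed

end
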